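(* Let $R$ be a finite commutative ring with identity and $P$ a proper prime ideal of $R$ with $|P|\geq 2$; let $I=I(\Gamma_P(R))\subseteq S=k[x_1,\ldots,x_a,y_1,\ldots,y_b]$ be the edge ideal of the prime ideal graph. For every integer $n\geq 1$, the ordinary power $I^n$ is polymatroidal.
   Context: The prime ideal graph $\Gamma_P(R)$ is the simple graph with vertex set $R\setminus\{0\}$ in which two distinct vertices $x,y$ are adjacent if and only if $xy\in P$. Put $a=|P|-1$ and $b=|P|(|R/P|-1)=|R\setminus P|$. Write $P\setminus\{0\}=\{u_1,\ldots,u_a\}$, $R\setminus P=\{v_1,\ldots,v_b\}$; attach the variable $x_i$ to $u_i$ and $y_\ell$ to $v_\ell$. Let $k$ be a field and $S=k[x_1,\ldots,x_a,y_1,\ldots,y_b]$. The edge ideal $I=I(\Gamma_P(R))$ is the ideal of $S$ generated by the products of the two variables attached to the endpoints of each edge; explicitly $I=(x_ix_j,\;x_iy_\ell \mid 1\leq i<j\leq a,\;1\leq i\leq a,\;1\leq \ell\leq b)$. $G(L)$ denotes the set of minimal monomial generators of a monomial ideal $L$. A monomial ideal $L\subseteq k[z_1,\ldots,z_r]$ generated in a single degree is polymatroidal if for any two monomials $u=z_1^{\alpha_1}\cdots z_r^{\alpha_r}$, $v=z_1^{\beta_1}\cdots z_r^{\beta_r}$ in $G(L)$ and any $i$ with $\alpha_i>\beta_i$, there exists $j$ with $\alpha_j<\beta_j$ and $z_ju/z_i\in G(L)$. *)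

theory Defs
  imports "HOL-Algebra.Ideal_Product" "HOL-Library.Poly_Mapping"
begin

text \<open>
  A monomial in variables indexed by \<open>'v\<close> is represented by its exponent vector, a finitely
  supported function \<open>'v \<Rightarrow>\<^sub>0 nat\<close>; so multiplication of monomials is addition of exponent vectors.
  A polynomial over \<open>'k\<close> is a finitely supported map from monomials to coefficients,
  with the (convolution) ring operations of HOL-Library.Poly_Mapping.
\<close>

type_synonym 'v monom = "'v \<Rightarrow>\<^sub>0 nat"
type_synonym ('v, 'k) mpoly = "'v monom \<Rightarrow>\<^sub>0 'k"

definition monoms_on :: "'v set \<Rightarrow> 'v monom set" where
  "monoms_on V = {m. Poly_Mapping.keys m \<subseteq> V}"

text \<open>The polynomial ring \<open>k[z\<^sub>v | v \<in> V]\<close>, as a ring in the sense of HOL-Algebra.\<close>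

definition poly_ring :: "'v set \<Rightarrow> ('v, 'k::field) mpoly ring" where
  "poly_ring V = \<lparr>carrier = {p. Poly_Mapping.keys p \<subseteq> monoms_on V}, mult = (*), one = 1, zero = 0, add = (+)\<rparr>"

definition monom_poly :: "'v monom \<Rightarrow> ('v, 'k::field) mpoly" where
  "monom_poly m = Poly_Mapping.single m 1"

definition var :: "'v \<Rightarrow> ('v, 'k::field) mpoly" where
  "var v = monom_poly (Poly_Mapping.single v 1)"

definition monom_degree :: "'v monom \<Rightarrow> nat" where
  "monom_degree m = (\<Sum>v\<in>Poly_Mapping.keys m. Poly_Mapping.lookup m v)"


section \<open>Monomial ideals\<close>

definition ideal_of_monoms :: "'v set \<Rightarrow> 'v monom set \<Rightarrow> ('v, 'k::field) mpoly set" where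
  "ideal_of_monoms V M = Idl\<^bsub>poly_ring V\<^esub> (monom_poly ` M)"

definition monomial_ideal :: "'v set \<Rightarrow> ('v, 'k::field) mpoly set \<Rightarrow> bool" where
  "monomial_ideal V L \<longleftrightarrow> (\<exists>M \<subseteq> monoms_on V. L = ideal_of_monoms V M)"

definition minimal_monom_generating_set ::
    "'v set \<Rightarrow> ('v, 'k::field) mpoly set \<Rightarrow> 'v monom set \<Rightarrow> bool" where
  "minimal_monom_generating_set V L M \<longleftrightarrow>
     M \<subseteq> monoms_on V \<and> ideal_of_monoms V M = L \<and> (\<forall>M'. M' \<subset> M \<longrightarrow> ideal_of_monoms V M' \<noteq> L)"

text \<open>
  The set \<open>G(L)\<close> (of exponent vectors). It is well defined for every monomial ideal \<open>L\<close>: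
  see \<open>minimal_monom_generating_set_ex1\<close> below.
\<close>

definition min_gens :: "'v set \<Rightarrow> ('v, 'k::field) mpoly set \<Rightarrow> 'v monom set" where
  "min_gens V L = (THE M. minimal_monom_generating_set V L M)"

text \<open>
  In the exchange property, \<open>u - single i 1 + single j 1\<close> is the monomial \<open>z\<^sub>j u / z\<^sub>i\<close>; the
  (truncated) subtraction is exact since \<open>Poly_Mapping.lookup u i > 0\<close>. As \<open>u\<close> and \<open>v\<close> only involve variables
  from \<open>V\<close>, the inequalities force \<open>i\<close> and \<open>j\<close> to lie in \<open>V\<close>.
\<close>

definition polymatroidal :: "'v set \<Rightarrow> ('v, 'k::field) mpoly set \<Rightarrow> bool" where
  "polymatroidal V L \<longleftrightarrow>
     monomial_ideal V L \<and>
     (\<exists>d. \<forall>m \<in> min_gens V L. monom_degree m = d) \<and>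
     (\<forall>u \<in> min_gens V L. \<forall>v \<in> min_gens V L. \<forall>i. Poly_Mapping.lookup u i > Poly_Mapping.lookup v i \<longrightarrow>
        (\<exists>j. Poly_Mapping.lookup u j < Poly_Mapping.lookup v j \<and>
             u - Poly_Mapping.single i 1 + Poly_Mapping.single j 1 \<in> min_gens V L))"


section \<open>Prime ideal graphs and edge ideals\<close>

text \<open>A simple graph is a pair of a vertex set and a set of two-element edges.\<close>

type_synonym 'v sgraph = "'v set \<times> 'v set set"

definition prime_ideal_graph :: "('a, 'm) ring_scheme \<Rightarrow> 'a set \<Rightarrow> 'a sgraph" where
  "prime_ideal_graph R P =
     (carrier R - {\<zero>\<^bsub>R\<^esub>},
      {{x, y} | x y. x \<in> carrier R - {\<zero>\<^bsub>R\<^esub>} \<and> y \<in> carrier R - {\<zero>\<^bsub>R\<^esub>} \<and> x \<noteq> y \<and> x \<otimes>\<^bsub>R\<^esub> y \<in> P})"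

text \<open>
  The variables are indexed by the vertices themselves: for the prime ideal graph, the
  variables \<open>x\<^sub>i\<close> are the \<open>var u\<close> with \<open>u \<in> P - {0}\<close>, the \<open>y\<^sub>l\<close> are the \<open>var v\<close> with \<open>v \<in> R - P\<close>.
\<close>

definition edge_ideal :: "'v sgraph \<Rightarrow> ('v, 'k::field) mpoly set" where
  "edge_ideal \<Gamma> =
     Idl\<^bsub>poly_ring (fst \<Gamma>)\<^esub> {var x \<otimes>\<^bsub>poly_ring (fst \<Gamma>)\<^esub> var y | x y. {x, y} \<in> snd \<Gamma>}"


section \<open>Well-definedness\<close>

lemma poly_ring_simps [simp]:
  "carrier (poly_ring V) = {p. Poly_Mapping.keys p \<subseteq> monoms_on V}"
  "mult (poly_ring V) = (*)" "one (poly_ring V) = 1" "zero (poly_ring V) = 0"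
  "add (poly_ring V) = (+)"
  by (simp_all add: poly_ring_def)

lemma monoms_on_add: "a \<in> monoms_on V \<Longrightarrow> b \<in> monoms_on V \<Longrightarrow> a + b \<in> monoms_on V"
  unfolding monoms_on_def using keys_add[of a b] by blast

lemma keys_mult_monoms_on:
  fixes x y :: "('v, 'k::field) mpoly"
  assumes "Poly_Mapping.keys x \<subseteq> monoms_on V" "Poly_Mapping.keys y \<subseteq> monoms_on V"
  shows "Poly_Mapping.keys (x * y) \<subseteq> monoms_on V"
proof
  fix m assume "m \<in> Poly_Mapping.keys (x * y)"
  with keys_mult[of x y] obtain a b
    where "m = a + b" "a \<in> Poly_Mapping.keys x" "b \<in> Poly_Mapping.keys y" by blast
  with assms show "m \<in> monoms_on V" using monoms_on_add by blast
qed

lemma cring_poly_ring: "cring (poly_ring V :: ('v, 'k::field) mpoly ring)"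
proof (rule cringI)
  show "abelian_group (poly_ring V :: ('v, 'k) mpoly ring)"
  proof (rule abelian_groupI, goal_cases)
    case (1 x y) then show ?case using keys_add[of x y] by auto
  next
    case (6 x) then show ?case by (auto intro!: exI[of _ "- x"])
  qed (auto simp: algebra_simps)
  show "Group.comm_monoid (poly_ring V :: ('v, 'k) mpoly ring)"
  proof (rule comm_monoidI, goal_cases)
    case (1 x y) then show ?case by (simp add: keys_mult_monoms_on)
  next
    case 2 then show ?case by (simp add: monoms_on_def)
  qed (auto simp: algebra_simps)
qed (auto simp: algebra_simps)

lemma monom_self_dvd: "m \<in> M \<Longrightarrow> \<exists>g\<in>M. \<exists>h. m = g + (h :: 'v monom)"
  by (intro bexI[of _ m] exI[of _ 0]) simp_all

text \<open>The set of polynomials all of whose monomials are divisible by an element of \<open>M\<close>.\<close>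

lemma keys_ideal_of_monoms:
  assumes M: "M \<subseteq> monoms_on V" and p: "(p :: ('v, 'k::field) mpoly) \<in> ideal_of_monoms V M"
    and m: "m \<in> Poly_Mapping.keys p"
  shows "\<exists>g\<in>M. \<exists>h. m = g + h"
proof -
  let ?S = "poly_ring V :: ('v, 'k) mpoly ring"
  interpret S: cring ?S by (rule cring_poly_ring)
  let ?J = "{p :: ('v, 'k) mpoly. Poly_Mapping.keys p \<subseteq> monoms_on V \<and> (\<forall>m\<in>Poly_Mapping.keys p. \<exists>g\<in>M. \<exists>h. m = g + h)}"
  have a_inv: "inv\<^bsub>add_monoid ?S\<^esub> x = - x" if "Poly_Mapping.keys x \<subseteq> monoms_on V" for x
  proof -
    have "\<ominus>\<^bsub>?S\<^esub> x = - x"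
      by (rule S.minus_equality) (use that in auto)
    then show ?thesis by (simp add: a_inv_def)
  qed
  have l: "x * a \<in> ?J" if a: "a \<in> ?J" and x: "Poly_Mapping.keys x \<subseteq> monoms_on V" for a x
  proof -
    have "\<exists>g\<in>M. \<exists>h. m = g + h" if "m \<in> Poly_Mapping.keys (x * a)" for m
    proof -
      from that keys_mult[of x a] obtain b c where "m = b + c" "c \<in> Poly_Mapping.keys a" by auto
      moreover from this a obtain g h where "g \<in> M" "c = g + h" by blast
      ultimately have "m = g + (b + h)" by (simp add: algebra_simps)
      with \<open>g \<in> M\<close> show ?thesis by blast
    qed
    moreover have "Poly_Mapping.keys (x * a) \<subseteq> monoms_on V"
      using a x by (simp add: keys_mult_monoms_on)
    ultimately show ?thesis by blast
  qed
  have "ideal ?J ?S"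
  proof (rule idealI)
    show "ring ?S" by (rule S.ring_axioms)
    show "subgroup ?J (add_monoid ?S)"
    proof (unfold_locales, goal_cases)
      case (2 x y)
      show ?case
      proof (simp, intro conjI ballI)
        show "Poly_Mapping.keys (x + y) \<subseteq> monoms_on V" using 2 keys_add[of x y] by blast
        fix m assume "m \<in> Poly_Mapping.keys (x + y)"
        then have "m \<in> Poly_Mapping.keys x \<or> m \<in> Poly_Mapping.keys y" using keys_add[of x y] by blast
        then show "\<exists>g\<in>M. \<exists>h. m = g + h" using 2 by blast
      qed
    next
      case (4 x) then show ?case using a_inv[of x] by simp
    qed auto
  next
    fix a x assume "a \<in> ?J" "x \<in> carrier ?S"
    then show "x \<otimes>\<^bsub>?S\<^esub> a \<in> ?J" "a \<otimes>\<^bsub>?S\<^esub> x \<in> ?J"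
      using l[of a x] by (simp_all add: mult.commute)
  qed
  moreover have "monom_poly ` M \<subseteq> ?J"
  proof
    fix p :: "('v, 'k) mpoly" assume "p \<in> monom_poly ` M"
    then obtain g where g: "g \<in> M" "p = monom_poly g" by blast
    with M monom_self_dvd[OF g(1)] show "p \<in> ?J" by (auto simp: monom_poly_def)
  qed
  ultimately have "ideal_of_monoms V M \<subseteq> ?J"
    unfolding ideal_of_monoms_def by (rule S.genideal_minimal)
  with p m show ?thesis by blast
qed

lemma monom_poly_in_carrier:
  "monom_poly ` M \<subseteq> carrier (poly_ring V :: ('v, 'k::field) mpoly ring) \<longleftrightarrow> M \<subseteq> monoms_on V"
  by (auto simp: monom_poly_def)

lemma monom_poly_in_ideal_of_monoms_iff:
  assumes M: "M \<subseteq> monoms_on V" and m: "m \<in> monoms_on V"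
  shows "(monom_poly m :: ('v, 'k::field) mpoly) \<in> ideal_of_monoms V M \<longleftrightarrow>
           (\<exists>g\<in>M. \<exists>h. m = g + h)"
proof
  assume "(monom_poly m :: ('v, 'k) mpoly) \<in> ideal_of_monoms V M"
  from keys_ideal_of_monoms[OF M this, of m] show "\<exists>g\<in>M. \<exists>h. m = g + h"
    by (simp add: monom_poly_def)
next
  let ?S = "poly_ring V :: ('v, 'k) mpoly ring"
  interpret S: cring ?S by (rule cring_poly_ring)
  assume "\<exists>g\<in>M. \<exists>h. m = g + h"
  then obtain g h where g: "g \<in> M" "m = g + h" by blast
  have I: "ideal (ideal_of_monoms V M) ?S"
    unfolding ideal_of_monoms_def using M S.genideal_ideal monom_poly_in_carrier by metis
  have "Poly_Mapping.keys h \<subseteq> Poly_Mapping.keys m" using g(2) by (auto simp: in_keys_iff lookup_add)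
  then have h: "h \<in> monoms_on V" using m by (auto simp: monoms_on_def)
  have "monom_poly g \<in> (ideal_of_monoms V M :: ('v, 'k) mpoly set)"
    unfolding ideal_of_monoms_def using M S.genideal_self g(1) monom_poly_in_carrier by blast
  from ideal.I_l_closed[OF I this, of "monom_poly h"] h
  show "(monom_poly m :: ('v, 'k) mpoly) \<in> ideal_of_monoms V M"
    by (simp add: monom_poly_def mult_single g(2) add.commute)
qed

lemma ideal_of_monoms_subset_iff:
  assumes "M \<subseteq> monoms_on V" "N \<subseteq> monoms_on V"
  shows "(ideal_of_monoms V M :: ('v, 'k::field) mpoly set) \<subseteq> ideal_of_monoms V N \<longleftrightarrow>
           (\<forall>m\<in>M. \<exists>g\<in>N. \<exists>h. m = g + h)"
proof -
  let ?S = "poly_ring V :: ('v, 'k) mpoly ring"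
  interpret S: cring ?S by (rule cring_poly_ring)
  have I: "ideal (ideal_of_monoms V N) ?S"
    unfolding ideal_of_monoms_def using assms S.genideal_ideal monom_poly_in_carrier by metis
  have "(ideal_of_monoms V M :: ('v, 'k) mpoly set) \<subseteq> ideal_of_monoms V N \<longleftrightarrow>
          monom_poly ` M \<subseteq> (ideal_of_monoms V N :: ('v, 'k) mpoly set)"
    unfolding ideal_of_monoms_def[of V M]
    by (rule S.Idl_subset_ideal) (use I assms monom_poly_in_carrier in blast)+
  also have "\<dots> \<longleftrightarrow> (\<forall>m\<in>M. \<exists>g\<in>N. \<exists>h. m = g + h)"
    using monom_poly_in_ideal_of_monoms_iff[OF assms(2)] assms(1) by blast
  finally show ?thesis .
qed

lemma monom_dvd_antisym:
  fixes a b :: "'v monom"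
  assumes "a = b + h" "b = a + h'"
  shows "a = b"
proof (rule poly_mapping_eqI)
  fix k
  have "Poly_Mapping.lookup a k = Poly_Mapping.lookup b k + Poly_Mapping.lookup h k" "Poly_Mapping.lookup b k = Poly_Mapping.lookup a k + Poly_Mapping.lookup h' k"
    using assms by (metis lookup_add)+
  then show "Poly_Mapping.lookup a k = Poly_Mapping.lookup b k" by simp
qed

lemma minimal_monom_generating_set_antichain:
  assumes M: "minimal_monom_generating_set V (L :: ('v, 'k::field) mpoly set) M"
    and a: "a \<in> M" "b \<in> M" "a = b + h"
  shows "a = b"
proof (rule ccontr)
  assume "a \<noteq> b"
  have MV: "M \<subseteq> monoms_on V" and L: "ideal_of_monoms V M = L"
    using M by (auto simp: minimal_monom_generating_set_def)
  have "\<exists>g\<in>M - {a}. \<exists>h. m = g + h" if "m \<in> M" for m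
  proof (cases "m = a")
    case True
    have "b \<in> M - {a}" using a(2) \<open>a \<noteq> b\<close> by blast
    with True a(3) show ?thesis by blast
  next
    case False
    with that show ?thesis by (intro monom_self_dvd) blast
  qed
  then have "(ideal_of_monoms V M :: ('v, 'k) mpoly set) \<subseteq> ideal_of_monoms V (M - {a})"
    using MV by (subst ideal_of_monoms_subset_iff) auto
  moreover have "(ideal_of_monoms V (M - {a}) :: ('v, 'k) mpoly set) \<subseteq> ideal_of_monoms V M"
    using MV by (subst ideal_of_monoms_subset_iff) (auto intro!: monom_self_dvd)
  ultimately have "ideal_of_monoms V (M - {a}) = L" using L by blast
  moreover have "M - {a} \<subset> M" using a(1) by blast
  ultimately show False using M by (auto simp: minimal_monom_generating_set_def)
qed

lemma minimal_monom_generating_set_unique: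
  assumes M: "minimal_monom_generating_set V (L :: ('v, 'k::field) mpoly set) M"
    and N: "minimal_monom_generating_set V L N"
  shows "M \<subseteq> N"
proof
  fix m assume m: "m \<in> M"
  have MV: "M \<subseteq> monoms_on V" "N \<subseteq> monoms_on V"
    and L: "ideal_of_monoms V M = L" "ideal_of_monoms V N = L"
    using M N by (auto simp: minimal_monom_generating_set_def)
  have 1: "\<forall>m\<in>M. \<exists>g\<in>N. \<exists>h. m = g + h"
    using ideal_of_monoms_subset_iff[OF MV, where 'k='k] L by simp
  have 2: "\<forall>m\<in>N. \<exists>g\<in>M. \<exists>h. m = g + h"
    using ideal_of_monoms_subset_iff[OF MV(2,1), where 'k='k] L by simp
  from 1 m obtain n h where n: "n \<in> N" "m = n + h" by blast
  from 2 n(1) obtain m' h' where m': "m' \<in> M" "n = m' + h'" by blast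
  have "m = m' + (h' + h)" using n m' by (simp add: add.assoc)
  with minimal_monom_generating_set_antichain[OF M m m'(1)] have "m = m'" by blast
  with n m' have "m = n" using monom_dvd_antisym by blast
  with n show "m \<in> N" by simp
qed

lemma monom_degree_add: "monom_degree (a + b) = monom_degree a + monom_degree b"
proof -
  have *: "monom_degree m = (\<Sum>v\<in>A. Poly_Mapping.lookup m v)" if "finite A" "Poly_Mapping.keys m \<subseteq> A"
    for m :: "'v monom" and A
    unfolding monom_degree_def by (rule sum.mono_neutral_left) (use that in \<open>auto simp: in_keys_iff\<close>)
  let ?A = "Poly_Mapping.keys a \<union> Poly_Mapping.keys b"
  have "monom_degree (a + b) = (\<Sum>v\<in>?A. Poly_Mapping.lookup (a + b) v)"
    using keys_add[of a b] by (intro *) auto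
  also have "\<dots> = (\<Sum>v\<in>?A. Poly_Mapping.lookup a v) + (\<Sum>v\<in>?A. Poly_Mapping.lookup b v)"
    by (simp add: lookup_add sum.distrib)
  also have "\<dots> = monom_degree a + monom_degree b"
    by (simp add: *[of ?A])
  finally show ?thesis .
qed

lemma monom_degree_eq_0_iff: "monom_degree m = 0 \<longleftrightarrow> m = 0"
  by (auto simp: monom_degree_def in_keys_iff intro: poly_mapping_eqI)

theorem minimal_monom_generating_set_ex1:
  fixes L :: "('v, 'k::field) mpoly set"
  assumes "monomial_ideal V L"
  shows "\<exists>!M. minimal_monom_generating_set V L M"
proof (rule ex_ex1I)
  obtain M where MV: "M \<subseteq> monoms_on V" and L: "L = ideal_of_monoms V M"
    using assms by (auto simp: monomial_ideal_def)
  define N where "N = {m \<in> M. \<forall>g\<in>M. \<forall>h. m = g + h \<longrightarrow> g = m}"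
  have NM: "N \<subseteq> M" by (auto simp: N_def)
  then have NV: "N \<subseteq> monoms_on V" using MV by blast
  have below: "\<exists>g\<in>N. \<exists>h. m = g + h" if "m \<in> M" for m
    using that
  proof (induction "monom_degree m" arbitrary: m rule: less_induct)
    case less
    show ?case
    proof (cases "m \<in> N")
      case True then show ?thesis by (rule monom_self_dvd)
    next
      case False
      then obtain g h where g: "g \<in> M" "m = g + h" "g \<noteq> m"
        using less.prems by (auto simp: N_def)
      then have "h \<noteq> 0" by auto
      then have "monom_degree g < monom_degree m"
        using g(2) monom_degree_eq_0_iff[of h] by (simp add: monom_degree_add)
      from less.hyps[OF this g(1)] obtain g' h' where "g' \<in> N" "g = g' + h'" by blast
      then show ?thesis using g(2) by (metis add.assoc)
    qed
  qed
  have "(ideal_of_monoms V M :: ('v, 'k) mpoly set) \<subseteq> ideal_of_monoms V N"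
    using below MV NV by (subst ideal_of_monoms_subset_iff) auto
  moreover have "(ideal_of_monoms V N :: ('v, 'k) mpoly set) \<subseteq> ideal_of_monoms V M"
    using MV NM NV by (subst ideal_of_monoms_subset_iff) (auto intro!: monom_self_dvd)
  ultimately have NL: "ideal_of_monoms V N = L" using L by blast
  have "ideal_of_monoms V N' \<noteq> L" if N': "N' \<subset> N" for N'
  proof
    assume eq: "ideal_of_monoms V N' = L"
    from N' obtain m where m: "m \<in> N" "m \<notin> N'" by blast
    have "N' \<subseteq> monoms_on V" using N' NV by blast
    with eq NL NV have "\<forall>m\<in>N. \<exists>g\<in>N'. \<exists>h. m = g + h"
      using ideal_of_monoms_subset_iff[of N V N', where 'k='k] by simp
    with m(1) obtain g h where "g \<in> N'" "m = g + h" by blast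
    moreover have "g \<in> M" using \<open>g \<in> N'\<close> N' NM by blast
    ultimately have "g = m" using m(1) by (auto simp: N_def)
    with \<open>g \<in> N'\<close> m(2) show False by simp
  qed
  with NL NV show "\<exists>M. minimal_monom_generating_set V L M"
    unfolding minimal_monom_generating_set_def by blast
next
  fix M N assume "minimal_monom_generating_set V L M" "minimal_monom_generating_set V L N"
  then show "M = N" using minimal_monom_generating_set_unique by blast
qed

text \<open>The explicit generators of the edge ideal: \<open>x\<^sub>i x\<^sub>j\<close> for \<open>i \<noteq> j\<close>, and \<open>x\<^sub>i y\<^sub>l\<close>.\<close>

lemma (in primeideal) edge_ideal_prime_ideal_graph:
  defines "V \<equiv> carrier R - {\<zero>}"
  shows "(edge_ideal (prime_ideal_graph R I) :: ('a, 'k::field) mpoly set) =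
           Idl\<^bsub>poly_ring V\<^esub> ({var u * var u' | u u'. u \<in> I - {\<zero>} \<and> u' \<in> I - {\<zero>} \<and> u \<noteq> u'} \<union>
                             {var u * var v | u v. u \<in> I - {\<zero>} \<and> v \<in> carrier R - I})"
proof -
  have edge: "{x, y} \<in> snd (prime_ideal_graph R I) \<longleftrightarrow> x \<in> V \<and> y \<in> V \<and> x \<noteq> y \<and> (x \<in> I \<or> y \<in> I)"
    for x y
  proof -
    have P: "x \<otimes> y \<in> I \<longleftrightarrow> x \<in> I \<or> y \<in> I" if "x \<in> carrier R" "y \<in> carrier R" for x y
      using I_prime[OF that] I_l_closed[of y x] I_r_closed[of x y] that by argo
    have "{x, y} \<in> snd (prime_ideal_graph R I) \<longleftrightarrow>
            (\<exists>x' y'. {x, y} = {x', y'} \<and> x' \<in> V \<and> y' \<in> V \<and> x' \<noteq> y' \<and> x' \<otimes> y' \<in> I)"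
      by (simp add: prime_ideal_graph_def V_def)
    also have "\<dots> \<longleftrightarrow> (\<exists>x' y'. {x, y} = {x', y'} \<and> x' \<in> V \<and> y' \<in> V \<and> x' \<noteq> y' \<and> (x' \<in> I \<or> y' \<in> I))"
    proof -
      have "x' \<otimes> y' \<in> I \<longleftrightarrow> x' \<in> I \<or> y' \<in> I" if "x' \<in> V" "y' \<in> V" for x' y'
        using P that by (simp add: V_def)
      then show ?thesis by (simp cong: conj_cong)
    qed
    also have "\<dots> \<longleftrightarrow> x \<in> V \<and> y \<in> V \<and> x \<noteq> y \<and> (x \<in> I \<or> y \<in> I)"
      unfolding doubleton_eq_iff by blast
    finally show ?thesis .
  qed
  have VI: "I \<subseteq> carrier R" using Icarr by blast
  have "{var x * var y | x y. {x, y} \<in> snd (prime_ideal_graph R I)} =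
          ({var u * var u' | u u'. u \<in> I - {\<zero>} \<and> u' \<in> I - {\<zero>} \<and> u \<noteq> u'} \<union>
           {var u * var v | u v. u \<in> I - {\<zero>} \<and> v \<in> carrier R - I} :: ('a, 'k) mpoly set)"
    (is "?A = ?B \<union> ?C")
  proof (intro equalityI subsetI)
    fix p assume "p \<in> ?A"
    then obtain x y where p: "p = var x * var y" and
      xy: "x \<in> V" "y \<in> V" "x \<noteq> y" "x \<in> I \<or> y \<in> I" unfolding edge by blast
    consider "x \<in> I" "y \<in> I" | "x \<in> I" "y \<notin> I" | "x \<notin> I" "y \<in> I" using xy(4) by blast
    then show "p \<in> ?B \<union> ?C"
    proof cases
      case 1 then have "p \<in> ?B" using p xy by (auto simp: V_def)
      then show ?thesis by blast
    next
      case 2 then have "p \<in> ?C" using p xy by (auto simp: V_def)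
      then show ?thesis by blast
    next
      case 3
      have "p = var y * var x" using p by (simp add: mult.commute)
      then have "p \<in> ?C" using 3 xy by (auto simp: V_def)
      then show ?thesis by blast
    qed
  next
    fix p assume "p \<in> ?B \<union> ?C"
    then obtain u w where p: "p = var u * var w" and
      uw: "u \<in> I - {\<zero>}" "w \<in> I - {\<zero>} \<and> u \<noteq> w \<or> w \<in> carrier R - I" by blast
    have "u \<in> V" "w \<in> V" "u \<noteq> w" using uw VI zero_closed by (auto simp: V_def)
    then show "p \<in> ?A" unfolding edge using p uw(1) by blast
  qed
  then show ?thesis
    by (simp add: edge_ideal_def prime_ideal_graph_def V_def)
qed

end

theory Submission
  imports Defs
begin

text \<open>
  Because \<open>P\<close> is prime, \<open>x \<otimes> y \<in> P\<close> exactly when \<open>x\<close> or \<open>y\<close> lies in \<open>P\<close>. So the prime ideal graph is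
  complete multipartite: every nonzero element of \<open>P\<close> is a part on its own, the complement of \<open>P\<close> is
  one more part, and two vertices are adjacent iff they lie in different parts
  (\<open>prime_ideal_graph_complete_multipartite\<close>). All powers of the edge ideal of any complete multipartite
  graph are polymatroidal, and that is what is proved.

  The generators of the \<open>n\<close>-th power are the products of \<open>n\<close> edges. An edge meets a part in at most one
  vertex, so such a product has degree \<open>2n\<close> and degree at most \<open>n\<close> in the variables of each part; call
  a monomial with these two properties balanced. Conversely every balanced monomial is a product of \<open>n\<close> edges
  (\<open>balanced_monoms_Suc\<close>): dividing by an edge between the two heaviest parts leaves a balanced
  monomial for \<open>n - 1\<close>, since at most two parts can reach the bound \<open>n\<close> when the total degree is \<open>2n\<close>.
  As all balanced monomials have the same degree, none properly divides another, and they are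
  the minimal generators.

  Balanced monomials have the exchange property (\<open>balanced_monoms_exchange\<close>) because the constraints
  only bound the degree in disjoint sets of variables. Let \<open>u\<close> exceed \<open>v\<close> in the variable \<open>i\<close>. If some \<open>j\<close>
  in the part of \<open>i\<close> has a smaller exponent in \<open>u\<close> than in \<open>v\<close>, exchanging \<open>i\<close> for \<open>j\<close> changes no degree
  in a part. Otherwise \<open>u\<close> has larger degree than \<open>v\<close> in the part of \<open>i\<close>, hence smaller degree than \<open>v\<close>
  in some other part; that part is below the bound for \<open>u\<close> and contains a suitable \<open>j\<close>.
\<close>

section \<open>Products and minimal generators of monomial ideals\<close>

text \<open>
  The ideal quotient \<open>K : S\<close>. It reduces containments between ideals given by generators to
  the generators themselves.
\<close>

lemma (in cring) colon_ideal:
  assumes K: "ideal K R" and S: "S \<subseteq> carrier R"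
  shows "ideal {x \<in> carrier R. \<forall>s\<in>S. x \<otimes> s \<in> K} R"
proof (rule idealI)
  interpret K: ideal K R by (rule K)
  show "ring R" by (rule ring_axioms)
  show "subgroup {x \<in> carrier R. \<forall>s\<in>S. x \<otimes> s \<in> K} (add_monoid R)"
  proof (rule add.subgroupI)
    show "{x \<in> carrier R. \<forall>s\<in>S. x \<otimes> s \<in> K} \<noteq> {}"
      using S K.zero_closed by (auto intro!: exI[of _ \<zero>])
  qed (use S in \<open>auto simp: l_distr l_minus subset_iff K.a_closed K.a_inv_closed\<close>)
next
  interpret K: ideal K R by (rule K)
  fix a x assume a: "a \<in> {x \<in> carrier R. \<forall>s\<in>S. x \<otimes> s \<in> K}" and x: "x \<in> carrier R"
  then show "x \<otimes> a \<in> {x \<in> carrier R. \<forall>s\<in>S. x \<otimes> s \<in> K}"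
    using S K.I_l_closed by (auto simp: m_assoc subset_iff)
  with a x show "a \<otimes> x \<in> {x \<in> carrier R. \<forall>s\<in>S. x \<otimes> s \<in> K}"
    by (simp add: m_comm)
qed

text \<open>
  For the inclusion from left to right, each generator of the first factor lies in the ideal
  quotient of the right-hand side by \<open>B\<close>, hence so does the whole first factor; the same argument is
  then repeated with the roles of the factors exchanged.
\<close>

lemma (in cring) ideal_prod_genideal:
  assumes A: "A \<subseteq> carrier R" and B: "B \<subseteq> carrier R"
  shows "(Idl A) \<cdot> (Idl B) = Idl (A <#> B)"
proof
  have AB: "A <#> B \<subseteq> carrier R" using A B by (auto simp: set_mult_def)
  note IA = genideal_ideal[OF A] and IB = genideal_ideal[OF B] and K = genideal_ideal[OF AB]
  have cA: "Idl A \<subseteq> carrier R" using ideal.Icarr[OF IA] by blast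
  show "Idl (A <#> B) \<subseteq> (Idl A) \<cdot> (Idl B)"
  proof (rule genideal_minimal[OF ideal_prod_is_ideal[OF IA IB]])
    show "A <#> B \<subseteq> (Idl A) \<cdot> (Idl B)"
      using genideal_self[OF A] genideal_self[OF B]
      by (auto simp: set_mult_def intro: ideal_prod.prod)
  qed
  have "A \<subseteq> {x \<in> carrier R. \<forall>s\<in>B. x \<otimes> s \<in> Idl (A <#> B)}"
    using A genideal_self[OF AB] by (auto simp: set_mult_def)
  then have 1: "Idl A \<subseteq> {x \<in> carrier R. \<forall>s\<in>B. x \<otimes> s \<in> Idl (A <#> B)}"
    by (rule genideal_minimal[OF colon_ideal[OF K B]])
  then have "B \<subseteq> {x \<in> carrier R. \<forall>s\<in>Idl A. x \<otimes> s \<in> Idl (A <#> B)}"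
    using B cA by (auto simp: subset_iff) (metis m_comm)
  then have 2: "Idl B \<subseteq> {x \<in> carrier R. \<forall>s\<in>Idl A. x \<otimes> s \<in> Idl (A <#> B)}"
    by (rule genideal_minimal[OF colon_ideal[OF K cA]])
  show "(Idl A) \<cdot> (Idl B) \<subseteq> Idl (A <#> B)"
  proof
    fix s assume "s \<in> (Idl A) \<cdot> (Idl B)"
    then show "s \<in> Idl (A <#> B)"
    proof induction
      case (prod i j)
      then have "j \<otimes> i \<in> Idl (A <#> B)" and "i \<in> carrier R" "j \<in> carrier R"
        using 2 cA ideal.Icarr[OF IB] by auto
      then show ?case by (simp add: m_comm)
    next
      case (sum s1 s2)
      then show ?case by (simp add: additive_subgroup.a_closed ideal.axioms(1)[OF K])
    qed
  qed
qed

lemma monom_poly_add: "monom_poly (m + m') = (monom_poly m * monom_poly m' :: ('v, 'k::field) mpoly)"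
  by (simp add: monom_poly_def mult_single)

lemma ideal_of_monoms_prod:
  assumes M: "M \<subseteq> monoms_on V" and N: "N \<subseteq> monoms_on V"
  shows "ideal_of_monoms V M \<cdot>\<^bsub>poly_ring V\<^esub> ideal_of_monoms V N =
           (ideal_of_monoms V {m + m' | m m'. m \<in> M \<and> m' \<in> N} :: ('v, 'k::field) mpoly set)"
proof -
  let ?S = "poly_ring V :: ('v, 'k) mpoly ring"
  interpret S: cring ?S by (rule cring_poly_ring)
  have "monom_poly ` M <#>\<^bsub>?S\<^esub> monom_poly ` N =
          (monom_poly ` {m + m' | m m'. m \<in> M \<and> m' \<in> N} :: ('v, 'k) mpoly set)"
    by (auto simp: set_mult_def monom_poly_add[symmetric])
  then show ?thesis
    using S.ideal_prod_genideal[of "monom_poly ` M" "monom_poly ` N"] M N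
    by (simp only: ideal_of_monoms_def monom_poly_in_carrier)
qed

lemma ideal_of_monoms_zero:
  "ideal_of_monoms V {0} = carrier (poly_ring V :: ('v, 'k::field) mpoly ring)"
proof -
  interpret S: cring "poly_ring V :: ('v, 'k) mpoly ring" by (rule cring_poly_ring)
  show ?thesis
    using S.genideal_one by (simp add: ideal_of_monoms_def monom_poly_def)
qed

text \<open>
  Among monomials of equal degree, divisibility is equality; so no generator can be omitted.
\<close>

lemma min_gens_ideal_of_monoms:
  assumes M: "M \<subseteq> monoms_on V" and deg: "\<And>m. m \<in> M \<Longrightarrow> monom_degree m = d"
  shows "min_gens V (ideal_of_monoms V M :: ('v, 'k::field) mpoly set) = M"
proof -
  let ?L = "ideal_of_monoms V M :: ('v, 'k) mpoly set"
  have "ideal_of_monoms V M' \<noteq> ?L" if M': "M' \<subset> M" for M'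
  proof
    assume eq: "ideal_of_monoms V M' = ?L"
    from M' obtain m where m: "m \<in> M" "m \<notin> M'" by blast
    have "M' \<subseteq> monoms_on V" using M M' by blast
    with eq M m(1) obtain g h where g: "g \<in> M'" "m = g + h"
      using ideal_of_monoms_subset_iff[of M V M', where 'k='k] by auto
    have "monom_degree g = d" "monom_degree m = d" using g(1) m(1) M' deg by auto
    then have "h = 0" using g(2) by (simp add: monom_degree_add monom_degree_eq_0_iff)
    with g m(2) show False by simp
  qed
  then have "minimal_monom_generating_set V ?L M"
    using M by (simp add: minimal_monom_generating_set_def)
  moreover have "monomial_ideal V ?L" using M by (auto simp: monomial_ideal_def)
  ultimately show ?thesis
    unfolding min_gens_def by (intro the1_equality minimal_monom_generating_set_ex1)
qed


section \<open>Degree of a monomial in a subset of the variables\<close>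

definition degree_in :: "'v set \<Rightarrow> 'v monom \<Rightarrow> nat" where
  "degree_in A m = (\<Sum>v\<in>Poly_Mapping.keys m \<inter> A. Poly_Mapping.lookup m v)"

lemma degree_in_UNIV: "degree_in UNIV m = monom_degree m"
  by (simp add: degree_in_def monom_degree_def)

lemma degree_in_eq_sum:
  assumes "finite S" "Poly_Mapping.keys m \<subseteq> S"
  shows "degree_in A m = (\<Sum>v\<in>S \<inter> A. Poly_Mapping.lookup m v)"
  unfolding degree_in_def
  by (rule sum.mono_neutral_left) (use assms in \<open>auto simp: in_keys_iff\<close>)

lemma degree_in_add: "degree_in A (m + m') = degree_in A m + degree_in A m'"
proof -
  let ?S = "Poly_Mapping.keys m \<union> Poly_Mapping.keys m'"
  have "finite ?S" "Poly_Mapping.keys (m + m') \<subseteq> ?S" using keys_add[of m m'] by auto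
  then show ?thesis
    by (simp add: degree_in_eq_sum[of ?S] lookup_add sum.distrib)
qed

lemma degree_in_single: "degree_in A (Poly_Mapping.single v k) = (if v \<in> A then k else 0)"
  by (simp add: degree_in_eq_sum[of "{v}"] Int_insert_left)

lemma monom_degree_single [simp]: "monom_degree (Poly_Mapping.single v k) = k"
  by (simp add: degree_in_UNIV[symmetric] degree_in_single)

lemma degree_in_less_imp_lookup_less:
  assumes "degree_in A u < degree_in A v"
  shows "\<exists>j\<in>A. Poly_Mapping.lookup u j < Poly_Mapping.lookup v j"
proof (rule ccontr)
  let ?S = "Poly_Mapping.keys u \<union> Poly_Mapping.keys v"
  assume "\<not> ?thesis"
  then have "degree_in A v \<le> degree_in A u"
    unfolding degree_in_eq_sum[of ?S v, simplified] degree_in_eq_sum[of ?S u, simplified]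
    by (intro sum_mono) (auto simp: not_less)
  with assms show False by simp
qed

lemma degree_in_mono:
  assumes "\<And>j. j \<in> A \<Longrightarrow> Poly_Mapping.lookup v j \<le> Poly_Mapping.lookup u j"
  shows "degree_in A v \<le> degree_in A u"
  using degree_in_less_imp_lookup_less[of A u v] assms by (meson not_less)

text \<open>
  A map \<open>c\<close> encodes a partition of the variables into its fibres, here called classes. The finite
  set \<open>S\<close> may exceed the support of \<open>m\<close>, so that the class degrees of two monomials can be summed over
  the same index set.
\<close>

lemma sum_degree_in_classes:
  assumes "finite S" "Poly_Mapping.keys m \<subseteq> S"
  shows "(\<Sum>k\<in>c ` S. degree_in (c -` {k}) m) = monom_degree m"
proof -
  have "monom_degree m = (\<Sum>v\<in>S. Poly_Mapping.lookup m v)"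
    using degree_in_eq_sum[OF assms, of UNIV] by (simp add: degree_in_UNIV)
  also have "\<dots> = (\<Sum>k\<in>c ` S. \<Sum>v | v \<in> S \<and> c v = k. Poly_Mapping.lookup m v)"
    by (rule sum.image_gen[OF assms(1)])
  also have "\<dots> = (\<Sum>k\<in>c ` S. degree_in (c -` {k}) m)"
    by (intro sum.cong refl) (auto simp: degree_in_eq_sum[OF assms] intro!: sum.cong)
  finally show ?thesis ..
qed

lemma degree_in_pos_iff: "0 < degree_in A m \<longleftrightarrow> Poly_Mapping.keys m \<inter> A \<noteq> {}"
  unfolding degree_in_def by (subst zero_less_iff_neq_zero) (auto simp: in_keys_iff)


section \<open>Balanced monomials\<close>

text \<open>
  These will be the products of \<open>n\<close> edges of the complete multipartite graph on \<open>V\<close> whose parts are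
  the fibres of \<open>c\<close>.
\<close>

definition balanced_monoms :: "'v set \<Rightarrow> ('v \<Rightarrow> 'c) \<Rightarrow> nat \<Rightarrow> 'v monom set" where
  "balanced_monoms V c n =
     {m \<in> monoms_on V. monom_degree m = 2 * n \<and> (\<forall>k. degree_in (c -` {k}) m \<le> n)}"

lemma balanced_monoms_0: "balanced_monoms V c 0 = {0}"
  by (auto simp: balanced_monoms_def monom_degree_eq_0_iff monoms_on_def degree_in_def)

lemma keys_imp_split_single:
  fixes m :: "'v monom"
  assumes "v \<in> Poly_Mapping.keys m"
  shows "m = Poly_Mapping.single v 1 + (m - Poly_Mapping.single v 1)"
proof (rule poly_mapping_eqI)
  fix k
  show "Poly_Mapping.lookup m k =
          Poly_Mapping.lookup (Poly_Mapping.single v 1 + (m - Poly_Mapping.single v 1)) k"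
    using assms
    by (cases "k = v") (auto simp: lookup_add lookup_minus lookup_single in_keys_iff Suc_leI)
qed

lemma monom_degree_pos_imp_split_single:
  assumes "0 < monom_degree m"
  obtains v m' where "m = Poly_Mapping.single v 1 + m'"
proof -
  have "Poly_Mapping.keys m \<noteq> {}" using assms by (auto simp: monom_degree_def)
  then obtain v where "v \<in> Poly_Mapping.keys m" by blast
  then show ?thesis by (rule that[OF keys_imp_split_single])
qed

text \<open>
  Exponents are natural numbers, so nothing cancels in the sum.
\<close>

lemma keys_add_monom: "Poly_Mapping.keys (a + b :: 'v monom) = Poly_Mapping.keys a \<union> Poly_Mapping.keys b"
  by (auto simp: in_keys_iff lookup_add)

lemma balanced_monoms_1:
  fixes V :: "'v set"
  shows
  "balanced_monoms V c 1 =
     {Poly_Mapping.single x 1 + Poly_Mapping.single y 1 | x y. x \<in> V \<and> y \<in> V \<and> c x \<noteq> c y}"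
proof (intro equalityI subsetI)
  fix m assume m: "m \<in> balanced_monoms V c 1"
  then have deg: "monom_degree m = 2" by (simp add: balanced_monoms_def)
  then obtain x m1 where x: "m = Poly_Mapping.single x 1 + m1"
    using monom_degree_pos_imp_split_single[of m] by auto
  with deg have deg1: "monom_degree m1 = 1" by (simp add: monom_degree_add)
  then obtain y m2 where y: "m1 = Poly_Mapping.single y 1 + m2"
    using monom_degree_pos_imp_split_single[of m1] by auto
  with deg1 have "m2 = 0" by (simp add: monom_degree_add monom_degree_eq_0_iff)
  with x y have eq: "m = Poly_Mapping.single x 1 + Poly_Mapping.single y 1" by simp
  have "degree_in (c -` {c x}) m \<le> 1" using m by (simp add: balanced_monoms_def)
  then have "c x \<noteq> c y" unfolding eq degree_in_add degree_in_single by auto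
  moreover have "x \<in> V" "y \<in> V"
    using m by (auto simp: eq balanced_monoms_def monoms_on_def keys_add_monom)
  ultimately show "m \<in> {Poly_Mapping.single x 1 + Poly_Mapping.single y 1 | x y.
                          x \<in> V \<and> y \<in> V \<and> c x \<noteq> c y}"
    using eq by blast
next
  fix m :: "'v monom"
  assume "m \<in> {Poly_Mapping.single x 1 + Poly_Mapping.single y 1 | x y.
                      x \<in> V \<and> y \<in> V \<and> c x \<noteq> c y}"
  then obtain x y where eq: "m = Poly_Mapping.single x 1 + Poly_Mapping.single y 1"
    and xy: "x \<in> V" "y \<in> V" "c x \<noteq> c y" by blast
  have "degree_in (c -` {k}) m \<le> 1" for k
    using xy(3) by (auto simp: eq degree_in_add degree_in_single)
  then show "m \<in> balanced_monoms V c 1"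
    using xy by (simp add: balanced_monoms_def eq monoms_on_def keys_add_monom monom_degree_add)
qed

lemma balanced_monoms_add:
  assumes "m \<in> balanced_monoms V c n" "m' \<in> balanced_monoms V c n'"
  shows "m + m' \<in> balanced_monoms V c (n + n')"
  using assms
  by (auto simp: balanced_monoms_def monoms_on_add monom_degree_add degree_in_add add_mono)

text \<open>
  The vertices \<open>x\<close> and \<open>y\<close> are taken from the two classes of largest degree. A further class of
  degree \<open>n + 1\<close> would force three classes of degree at least \<open>n + 1\<close>, more than the total \<open>2 (n + 1)\<close> allows.
\<close>

lemma exists_two_heaviest_classes:
  assumes deg: "monom_degree m = 2 * Suc n" and le: "\<And>k. degree_in (c -` {k}) m \<le> Suc n"
  obtains x y where "x \<in> Poly_Mapping.keys m" "y \<in> Poly_Mapping.keys m" "c x \<noteq> c y"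
    "\<And>k. degree_in (c -` {k}) m = Suc n \<Longrightarrow> k = c x \<or> k = c y"
proof -
  let ?w = "\<lambda>k. degree_in (c -` {k}) m" and ?K = "c ` Poly_Mapping.keys m"
  have max: "\<exists>k\<in>A. \<forall>k'\<in>A. ?w k' \<le> ?w k" if "finite A" "A \<noteq> {}" for A
  proof -
    from that Max_in[of "?w ` A"] have "Max (?w ` A) \<in> ?w ` A" by simp
    then obtain k where "k \<in> A" "Max (?w ` A) = ?w k" by (rule imageE)
    moreover have "?w k' \<le> Max (?w ` A)" if "k' \<in> A" for k'
      using that \<open>finite A\<close> by (intro Max_ge) auto
    ultimately show ?thesis by auto
  qed
  have total: "(\<Sum>k\<in>?K. ?w k) = 2 * Suc n"
    using sum_degree_in_classes[of "Poly_Mapping.keys m" m c] deg by simp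
  then have "?K \<noteq> {}" by auto
  then obtain k1 where k1: "k1 \<in> ?K" "\<And>k. k \<in> ?K \<Longrightarrow> ?w k \<le> ?w k1"
    using max[of ?K] by auto
  \<comment> \<open>a single class has degree at most half of the total\<close>
  have "?K - {k1} \<noteq> {}"
  proof
    assume "?K - {k1} = {}"
    with k1(1) have "?K = {k1}" by blast
    with total le[of k1] show False by simp
  qed
  then obtain k2 where k2: "k2 \<in> ?K - {k1}" "\<And>k. k \<in> ?K - {k1} \<Longrightarrow> ?w k \<le> ?w k2"
    using max[of "?K - {k1}"] by auto
  have heavy: "k = k1 \<or> k = k2" if k: "?w k = Suc n" for k
  proof (rule ccontr)
    assume neq: "\<not> ?thesis"
    from k have "k \<in> ?K" using degree_in_pos_iff[of "c -` {k}" m] by auto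
    then have ge: "?w k \<le> ?w k1" "?w k \<le> ?w k2" using k1(2) k2(2) neq by blast+
    have "?w k1 + ?w k2 + ?w k = (\<Sum>k\<in>{k1, k2, k}. ?w k)" using neq k2(1) by auto
    also have "\<dots> \<le> (\<Sum>k\<in>?K. ?w k)"
      using k1(1) k2(1) \<open>k \<in> ?K\<close> by (intro sum_mono2) auto
    finally have "?w k1 + ?w k2 + ?w k \<le> 2 * Suc n" unfolding total .
    with ge k show False by simp
  qed
  from k1(1) k2(1) obtain x y where "x \<in> Poly_Mapping.keys m" "y \<in> Poly_Mapping.keys m"
    "k1 = c x" "k2 = c y" "c x \<noteq> c y" by auto
  with heavy show ?thesis by (intro that[of x y]) auto
qed

text \<open>
  Splitting off an edge keeps a monomial balanced only if the edge lowers the degree in every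
  class that attains the bound; this dictates the choice of its endpoints.
\<close>

lemma balanced_monoms_Suc:
  "balanced_monoms V c (Suc n) =
     {m + e | m e. m \<in> balanced_monoms V c n \<and> e \<in> balanced_monoms V c 1}"
proof (intro equalityI subsetI)
  fix m assume m: "m \<in> balanced_monoms V c (Suc n)"
  then obtain x y where xy: "x \<in> Poly_Mapping.keys m" "y \<in> Poly_Mapping.keys m" "c x \<noteq> c y"
    and heavy: "\<And>k. degree_in (c -` {k}) m = Suc n \<Longrightarrow> k = c x \<or> k = c y"
    unfolding balanced_monoms_def by (blast intro: exists_two_heaviest_classes)
  let ?e = "Poly_Mapping.single x 1 + Poly_Mapping.single y (1::nat)"
  define m' where "m' = m - ?e"
  have eq: "m = m' + ?e"
    unfolding m'_def using xy
    by (intro poly_mapping_eqI)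
       (auto simp: lookup_add lookup_minus lookup_single in_keys_iff when_def)
  have V: "Poly_Mapping.keys m \<subseteq> V" and le: "degree_in (c -` {k}) m \<le> Suc n" for k
    using m by (auto simp: balanced_monoms_def monoms_on_def)
  have "degree_in (c -` {k}) m' \<le> n" for k
  proof (cases "k = c x \<or> k = c y")
    case True
    then show ?thesis
      using le[of k] xy(3) by (auto simp: eq degree_in_add degree_in_single)
  next
    case False
    then have "degree_in (c -` {k}) m \<noteq> Suc n" using heavy by blast
    then show ?thesis using le[of k] by (simp add: eq degree_in_add)
  qed
  moreover have "monom_degree m' = 2 * n"
    using m by (simp add: balanced_monoms_def eq monom_degree_add)
  moreover have "m' \<in> monoms_on V"
    using V by (auto simp: eq monoms_on_def keys_add_monom)
  ultimately have "m' \<in> balanced_monoms V c n" by (simp add: balanced_monoms_def)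
  moreover have "?e \<in> balanced_monoms V c 1"
    unfolding balanced_monoms_1 using xy V by blast
  ultimately show "m \<in> {m + e | m e. m \<in> balanced_monoms V c n \<and> e \<in> balanced_monoms V c 1}"
    using eq by blast
qed (use balanced_monoms_add[of _ V c n _ 1] in auto)

text \<open>
  Monomials with bounds on the degrees in disjoint sets of variables behave like the bases of a
  partition matroid, with multiplicities.
\<close>

lemma balanced_monoms_exchange:
  assumes u: "u \<in> balanced_monoms V c n" and v: "v \<in> balanced_monoms V c n"
    and i: "Poly_Mapping.lookup u i > Poly_Mapping.lookup v i"
  shows "\<exists>j. Poly_Mapping.lookup u j < Poly_Mapping.lookup v j \<and>
             u - Poly_Mapping.single i 1 + Poly_Mapping.single j 1 \<in> balanced_monoms V c n"
proof -
  let ?w = "\<lambda>k. degree_in (c -` {k})"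
  define u' where "u' = u - Poly_Mapping.single i 1"
  have eq: "u = Poly_Mapping.single i 1 + u'"
    unfolding u'_def by (rule keys_imp_split_single) (use i in \<open>auto simp: in_keys_iff\<close>)
  have deg: "monom_degree u = 2 * n" "monom_degree v = 2 * n"
    and le: "?w k u \<le> n" "?w k v \<le> n" for k
    using u v by (auto simp: balanced_monoms_def)
  \<comment> \<open>The class of \<open>j\<close> must have room for one more variable once \<open>i\<close> is removed.\<close>
  obtain j where j: "Poly_Mapping.lookup u j < Poly_Mapping.lookup v j"
    and cj: "c j = c i \<or> ?w (c j) u < n"
  proof (cases "\<exists>j. c j = c i \<and> Poly_Mapping.lookup u j < Poly_Mapping.lookup v j")
    case True
    then show ?thesis using that by blast
  next
    case False
    have "?w (c i) v \<le> ?w (c i) u'"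
    proof (rule degree_in_mono)
      fix j assume "j \<in> c -` {c i}"
      then have "Poly_Mapping.lookup v j \<le> Poly_Mapping.lookup u j" using False by force
      \<comment> \<open>at \<open>j = i\<close> this is the strict inequality at \<open>i\<close>\<close>
      then show "Poly_Mapping.lookup v j \<le> Poly_Mapping.lookup u' j"
        using i by (auto simp: u'_def lookup_minus lookup_single when_def)
    qed
    then have lt: "?w (c i) v < ?w (c i) u"
      by (simp add: eq degree_in_add degree_in_single)
    let ?S = "Poly_Mapping.keys u \<union> Poly_Mapping.keys v"
    have sums: "(\<Sum>k\<in>c ` ?S. ?w k v) = (\<Sum>k\<in>c ` ?S. ?w k u)"
      using deg by (simp add: sum_degree_in_classes)
    have "i \<in> ?S" using i by (auto simp: in_keys_iff)
    have "\<exists>k. ?w k u < ?w k v"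
    proof (rule ccontr)
      assume "\<not> ?thesis"
      then have "(\<Sum>k\<in>c ` ?S. ?w k v) < (\<Sum>k\<in>c ` ?S. ?w k u)"
        using lt \<open>i \<in> ?S\<close> by (intro sum_strict_mono_ex1) (auto simp: not_less)
      with sums show False by simp
    qed
    then obtain k where k: "?w k u < ?w k v" ..
    then obtain j where "c j = k" "Poly_Mapping.lookup u j < Poly_Mapping.lookup v j"
      using degree_in_less_imp_lookup_less by blast
    moreover have "?w k u < n" using k le(2)[of k] by simp
    ultimately show ?thesis using that by blast
  qed
  have "?w k (u' + Poly_Mapping.single j 1) \<le> n" for k
    using le(1)[of k] cj by (auto simp: eq degree_in_add degree_in_single split: if_splits)
  moreover have "monom_degree (u' + Poly_Mapping.single j 1) = 2 * n"
    using deg(1) by (simp add: eq monom_degree_add)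
  moreover have "j \<in> V"
    using j v by (auto simp: balanced_monoms_def monoms_on_def in_keys_iff subset_iff)
  then have "u' + Poly_Mapping.single j 1 \<in> monoms_on V"
    using u by (auto simp: eq balanced_monoms_def monoms_on_def keys_add_monom)
  ultimately have "u' + Poly_Mapping.single j 1 \<in> balanced_monoms V c n"
    by (simp add: balanced_monoms_def)
  with j show ?thesis unfolding u'_def by blast
qed


section \<open>Complete multipartite graphs\<close>

definition complete_multipartite :: "'v set \<Rightarrow> ('v \<Rightarrow> 'c) \<Rightarrow> 'v sgraph" where
  "complete_multipartite V c = (V, {{x, y} | x y. x \<in> V \<and> y \<in> V \<and> c x \<noteq> c y})"

lemma edge_ideal_complete_multipartite:
  "(edge_ideal (complete_multipartite V c) :: ('v, 'k::field) mpoly set) =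
     ideal_of_monoms V (balanced_monoms V c 1)"
proof -
  have "{x, y} \<in> snd (complete_multipartite V c) \<longleftrightarrow> x \<in> V \<and> y \<in> V \<and> c x \<noteq> c y" for x y
    by (auto simp: complete_multipartite_def doubleton_eq_iff)
  then have "{var x * var y | x y. {x, y} \<in> snd (complete_multipartite V c)} =
          (monom_poly ` balanced_monoms V c 1 :: ('v, 'k) mpoly set)"
    unfolding balanced_monoms_1 by (force simp: var_def monom_poly_add)
  then show ?thesis
    by (simp add: edge_ideal_def ideal_of_monoms_def complete_multipartite_def)
qed

text \<open>
  The zeroth power is the unit ideal, generated by the monomial \<open>1\<close>, whose exponent vector \<open>0\<close> is the
  only balanced monomial for \<open>n = 0\<close>; so the induction can start there.
\<close>

lemma edge_ideal_complete_multipartite_pow: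
  "(edge_ideal (complete_multipartite V c) :: ('v, 'k::field) mpoly set)
     [^]\<^bsub>ideals_set (poly_ring V)\<^esub> n = ideal_of_monoms V (balanced_monoms V c n)"
proof (induction n)
  case 0
  show ?case
    by (simp add: balanced_monoms_0 ideal_of_monoms_zero ideals_set_def del: poly_ring_simps)
next
  case (Suc n)
  have "balanced_monoms V c n \<subseteq> monoms_on V" for n by (auto simp: balanced_monoms_def)
  with Suc show ?case
    by (simp add: ideals_set_def edge_ideal_complete_multipartite ideal_of_monoms_prod
          balanced_monoms_Suc[of V c n] del: poly_ring_simps One_nat_def)
qed

theorem polymatroidal_edge_ideal_complete_multipartite_pow:
  fixes n :: nat
  shows
  "polymatroidal V ((edge_ideal (complete_multipartite V c) :: ('v, 'k::field) mpoly set)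
     [^]\<^bsub>ideals_set (poly_ring V)\<^esub> n)"
proof -
  have B: "balanced_monoms V c n \<subseteq> monoms_on V"
    "\<And>m. m \<in> balanced_monoms V c n \<Longrightarrow> monom_degree m = 2 * n"
    by (auto simp: balanced_monoms_def)
  have "min_gens V (ideal_of_monoms V (balanced_monoms V c n) :: ('v, 'k) mpoly set) =
          balanced_monoms V c n"
    by (rule min_gens_ideal_of_monoms[where d = "2 * n"]) (use B in auto)
  then show ?thesis
    unfolding polymatroidal_def edge_ideal_complete_multipartite_pow monomial_ideal_def
    using B by (auto intro: balanced_monoms_exchange simp del: One_nat_def)
qed


section \<open>Prime ideal graphs\<close>

lemma (in primeideal) prime_ideal_graph_complete_multipartite:
  "prime_ideal_graph R I =
     complete_multipartite (carrier R - {\<zero>}) (\<lambda>x. if x \<in> I then {x} else carrier R - I)"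
    (is "_ = complete_multipartite ?V ?c")
proof -
  have "x \<noteq> y \<and> x \<otimes> y \<in> I \<longleftrightarrow> ?c x \<noteq> ?c y" if xy: "x \<in> ?V" "y \<in> ?V" for x y
  proof -
    have "x \<otimes> y \<in> I \<longleftrightarrow> x \<in> I \<or> y \<in> I"
      using xy I_prime[of x y] I_l_closed[of y x] I_r_closed[of x y] by auto
    then show ?thesis using xy by auto
  qed
  then show ?thesis
    unfolding prime_ideal_graph_def complete_multipartite_def by (simp cong: conj_cong)
qed

theorem theorem6p3:
  fixes R :: "('a, 'm) ring_scheme" and P :: "'a set" and n :: nat
  assumes "cring R" and "finite (carrier R)"
    and "primeideal P R" and "card P \<ge> 2"
    and "n \<ge> 1"
  shows "polymatroidal (fst (prime_ideal_graph R P))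
           ((edge_ideal (prime_ideal_graph R P))
              [^]\<^bsub>ideals_set (poly_ring (fst (prime_ideal_graph R P)) :: ('a, 'k::field) mpoly ring)\<^esub> n)"
proof -
  let ?c = "\<lambda>x. if x \<in> P then {x} else carrier R - P"
  have "prime_ideal_graph R P = complete_multipartite (carrier R - {\<zero>\<^bsub>R\<^esub>}) ?c"
    by (rule primeideal.prime_ideal_graph_complete_multipartite[OF assms(3)])
  moreover have "fst (complete_multipartite (carrier R - {\<zero>\<^bsub>R\<^esub>}) ?c) = carrier R - {\<zero>\<^bsub>R\<^esub>}"
    by (simp add: complete_multipartite_def)
  ultimately show ?thesis
    by (simp only: polymatroidal_edge_ideal_complete_multipartite_pow)
qed

end
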